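(* Let $\mathbf z_e$ be an Eulerian relative equilibrium of the gyrostat–two-rigid-bodies system. Then the equation $$m_0(m_1+m_2)\big((1+\rho)m_2+\rho m_1\big)h_1(\rho)=m_1m_2(m_0+m_1+m_2)h_2(\rho)$$ has at least one real root $\rho$, where $$h_1(\rho)=\frac{Gm_1m_2}{|\lambda^e|^3}+\frac{Gm_0m_1\,\mathrm{sgn}(1+\rho)}{M_2|\lambda^e|^3}\Big(\frac{m_2}{(1+\rho)^2}+\frac{\beta_2}{(1+\rho)^4|\lambda^e|^2}\Big)-\frac{Gm_0m_2\,\mathrm{sgn}(\rho)}{M_2|\lambda^e|^3}\Big(\frac{m_1}{\rho^2}+\frac{\beta_1}{\rho^4|\lambda^e|^2}\Big),$$ $$h_2(\rho)=\frac{Gm_0\,\mathrm{sgn}(1+\rho)}{|\lambda^e|^3}\Big(\frac{m_2}{(1+\rho)^2}+\frac{\beta_2}{|\lambda^e|^2(1+\rho)^4}\Big)+\frac{Gm_0\,\mathrm{sgn}(\rho)}{|\lambda^e|^3}\Big(\frac{m_1}{\rho^2}+\frac{\beta_1}{|\lambda^e|^2\rho^4}\Big),$$ and for such a root (the one determined by $\mu^e-\frac{m_2}{M_2}\lambda^e=\rho\lambda^e$) the modulus of the angular velocity of the gyrostat is given by $$|\Omega_0^e|^2=\frac{m_1+m_2}{m_1m_2}h_1(\rho).$$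
   Context: Setting. $G>0$; $m_0,m_1,m_2>0$ are the masses of a gyrostat $S_0$ and two symmetric rigid bodies $S_1,S_2$. Put $M_2=m_1+m_2$, $M_1=m_0+m_1+m_2$, $g_1=m_1m_2/M_2$, $g_2=m_0M_2/M_1$. Inertia tensors: $\mathbb I_i=\mathrm{diag}(A_i,A_i,C_i)$, $A_i,C_i>0$, $i=0,1,2$; $\beta_i=\frac32(C_i-A_i)$ for $i=1,2$. $\mathrm{sgn}(x)=1$ if $x>0$ and $-1$ if $x\le0$. The gyrostatic momentum is the constant vector $l_r=(0,0,l)$. The state is $\mathbf z=(\Pi_1,\Pi_2,\Pi_0,\lambda,p_\lambda,\mu,p_\mu)\in\mathbb R^{21}$ (seven vectors of $\mathbb R^3$), with $\Pi_0=\mathbb I_0\Omega_0+l_r$ and $\Pi_i=\mathbb I_i\Omega_i$ ($i=1,2$). Put $x_1=\mu-\frac{m_2}{M_2}\lambda$, $x_2=\mu+\frac{m_1}{M_2}\lambda$. The potential is $\mathcal V=\mathcal V_1+\mathcal V_2$ (defined for $\lambda,x_1,x_2\ne0$), where $$\mathcal V_1=-\Big(\frac{Gm_1m_2}{|\lambda|}+\frac{Gm_1m_0}{|x_1|}+\frac{Gm_2m_0}{|x_2|}\Big),\qquad \mathcal V_2=-\frac12\sum_{i=1}^2\Big(\frac{Gm_0(2A_i+C_i)}{|x_i|^3}-\frac{3Gm_0\,x_i\cdot\mathbb I_ix_i}{|x_i|^5}\Big).$$ A relative equilibrium $\mathbf z_e$ is a state satisfying $$\Pi_0^e\times\Omega_0^e+\lambda^e\times(\nabla_\lambda\mathcal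 V)_e+\mu^e\times(\nabla_\mu\mathcal V)_e=0,$$ $$\frac{p_\lambda^e}{g_1}+\lambda^e\times\Omega_0^e=0,\quad p_\lambda^e\times\Omega_0^e=(\nabla_\lambda\mathcal V)_e,\quad \frac{p_\mu^e}{g_2}+\mu^e\times\Omega_0^e=0,\quad p_\mu^e\times\Omega_0^e=(\nabla_\mu\mathcal V)_e,$$ $$\Pi_1^e\times\Omega_1^e=0,\quad \Pi_2^e\times\Omega_2^e=0.$$ It is Eulerian if $\lambda^e$ and $\mu^e$ are proportional and $\Omega_0^e$ is perpendicular to the straight line they generate. Standing convention of the paper: at Eulerian and Lagrangian relative equilibria the gradients of $\mathcal V$ take the values (those obtained when $\lambda^e,\mu^e$ lie in the plane of vectors with vanishing third component) $$(\nabla_\lambda\mathcal V)_e=\frac{Gm_1m_2\lambda^e}{|\lambda^e|^3}-\frac{Gm_0m_2}{M_2}\Big(\frac{m_1}{|x_1^e|^3}+\frac{\beta_1}{|x_1^e|^5}\Big)x_1^e+\frac{Gm_0m_1}{M_2}\Big(\frac{m_2}{|x_2^e|^3}+\frac{\beta_2}{|x_2^e|^5}\Big)x_2^e,$$ $$(\nabla_\mu\mathcal V)_e=Gm_0\Big(\frac{m_1}{|x_1^e|^3}+\frac{\beta_1}{|x_1^e|^5}\Big)x_1^e+Gm_0\Big(\frac{m_2}{|x_2^e|^3}+\frac{\beta_2}{|x_2^e|^5}\Big)x_2^e .$$ *)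

theory Defs
  imports "HOL-Analysis.Analysis"
begin

text \<open>
  The gyrostat is body 0, the symmetric rigid bodies are bodies 1 and 2; the fields
  \<open>A0, \<dots>, C2\<close> are the principal moments of inertia and \<open>gyro\<close> is the third component
  of the gyrostatic momentum.
\<close>

record params =
  grav :: real
  m0 :: real
  m1 :: real
  m2 :: real
  A0 :: real
  A1 :: real
  A2 :: real
  C0 :: real
  C1 :: real
  C2 :: real
  gyro :: real

definition admissible :: "params \<Rightarrow> bool" where
  "admissible P \<longleftrightarrow> grav P > 0 \<and> m0 P > 0 \<and> m1 P > 0 \<and> m2 P > 0 \<and>
     A0 P > 0 \<and> A1 P > 0 \<and> A2 P > 0 \<and> C0 P > 0 \<and> C1 P > 0 \<and> C2 P > 0"

definition M2 :: "params \<Rightarrow> real" where "M2 P = m1 P + m2 P"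
definition M1 :: "params \<Rightarrow> real" where "M1 P = m0 P + m1 P + m2 P"
definition g1 :: "params \<Rightarrow> real" where "g1 P = m1 P * m2 P / M2 P"
definition g2 :: "params \<Rightarrow> real" where "g2 P = m0 P * M2 P / M1 P"
definition beta1 :: "params \<Rightarrow> real" where "beta1 P = 3 / 2 * (C1 P - A1 P)"
definition beta2 :: "params \<Rightarrow> real" where "beta2 P = 3 / 2 * (C2 P - A2 P)"

definition inertia :: "real \<Rightarrow> real \<Rightarrow> real^3^3" where
  "inertia A C = (\<chi> i j. if i = j then (if i = 3 then C else A) else 0)"

definition I0 :: "params \<Rightarrow> real^3^3" where "I0 P = inertia (A0 P) (C0 P)"
definition I1 :: "params \<Rightarrow> real^3^3" where "I1 P = inertia (A1 P) (C1 P)"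
definition I2 :: "params \<Rightarrow> real^3^3" where "I2 P = inertia (A2 P) (C2 P)"

definition gyro_momentum :: "params \<Rightarrow> real^3" where
  "gyro_momentum P = vector [0, 0, gyro P]"

text \<open>Unlike the library function \<^const>\<open>sgn\<close>, this one takes the value \<open>-1\<close> at \<open>0\<close>.\<close>

definition sgn_pm :: "real \<Rightarrow> real" where
  "sgn_pm x = (if x > 0 then 1 else -1)"


record state =
  Pi1 :: "real^3"
  Pi2 :: "real^3"
  Pi0 :: "real^3"
  lam :: "real^3"
  p_lam :: "real^3"
  mu :: "real^3"
  p_mu :: "real^3"

definition Omega0 :: "params \<Rightarrow> state \<Rightarrow> real^3" where
  "Omega0 P z = matrix_inv (I0 P) *v (Pi0 z - gyro_momentum P)"

definition Omega1 :: "params \<Rightarrow> state \<Rightarrow> real^3" where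
  "Omega1 P z = matrix_inv (I1 P) *v Pi1 z"

definition Omega2 :: "params \<Rightarrow> state \<Rightarrow> real^3" where
  "Omega2 P z = matrix_inv (I2 P) *v Pi2 z"

definition x1 :: "params \<Rightarrow> real^3 \<Rightarrow> real^3 \<Rightarrow> real^3" where
  "x1 P l m = m - (m2 P / M2 P) *\<^sub>R l"

definition x2 :: "params \<Rightarrow> real^3 \<Rightarrow> real^3 \<Rightarrow> real^3" where
  "x2 P l m = m + (m1 P / M2 P) *\<^sub>R l"

definition V1 :: "params \<Rightarrow> real^3 \<Rightarrow> real^3 \<Rightarrow> real" where
  "V1 P l m = - (grav P * m1 P * m2 P / norm l
     + grav P * m1 P * m0 P / norm (x1 P l m)
     + grav P * m2 P * m0 P / norm (x2 P l m))"

definition V2 :: "params \<Rightarrow> real^3 \<Rightarrow> real^3 \<Rightarrow> real" where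
  "V2 P l m = - (1 / 2) *
     ((grav P * m0 P * (2 * A1 P + C1 P) / norm (x1 P l m) ^ 3
        - 3 * grav P * m0 P * (x1 P l m \<bullet> (I1 P *v x1 P l m)) / norm (x1 P l m) ^ 5)
    + (grav P * m0 P * (2 * A2 P + C2 P) / norm (x2 P l m) ^ 3
        - 3 * grav P * m0 P * (x2 P l m \<bullet> (I2 P *v x2 P l m)) / norm (x2 P l m) ^ 5))"

definition potential :: "params \<Rightarrow> real^3 \<Rightarrow> real^3 \<Rightarrow> real" where
  "potential P l m = V1 P l m + V2 P l m"

definition gradient :: "('a::real_inner \<Rightarrow> real) \<Rightarrow> 'a \<Rightarrow> 'a" where
  "gradient f x = (THE D. GDERIV f x :> D)"

definition grad_lam :: "params \<Rightarrow> state \<Rightarrow> real^3" where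
  "grad_lam P z = gradient (\<lambda>l. potential P l (mu z)) (lam z)"

definition grad_mu :: "params \<Rightarrow> state \<Rightarrow> real^3" where
  "grad_mu P z = gradient (\<lambda>m. potential P (lam z) m) (mu z)"

text \<open>
  The first three conditions place the state in the domain of the potential.
\<close>

definition relative_equilibrium :: "params \<Rightarrow> state \<Rightarrow> bool" where
  "relative_equilibrium P z \<longleftrightarrow>
     lam z \<noteq> 0 \<and> x1 P (lam z) (mu z) \<noteq> 0 \<and> x2 P (lam z) (mu z) \<noteq> 0 \<and>
     cross3 (Pi0 z) (Omega0 P z) + cross3 (lam z) (grad_lam P z)
       + cross3 (mu z) (grad_mu P z) = 0 \<and>
     (1 / g1 P) *\<^sub>R p_lam z + cross3 (lam z) (Omega0 P z) = 0 \<and>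
     cross3 (p_lam z) (Omega0 P z) = grad_lam P z \<and>
     (1 / g2 P) *\<^sub>R p_mu z + cross3 (mu z) (Omega0 P z) = 0 \<and>
     cross3 (p_mu z) (Omega0 P z) = grad_mu P z \<and>
     cross3 (Pi1 z) (Omega1 P z) = 0 \<and>
     cross3 (Pi2 z) (Omega2 P z) = 0"

definition eulerian_equilibrium :: "params \<Rightarrow> state \<Rightarrow> bool" where
  "eulerian_equilibrium P z \<longleftrightarrow> relative_equilibrium P z \<and>
     collinear {0, lam z, mu z} \<and>
     (\<forall>v \<in> span {lam z, mu z}. orthogonal (Omega0 P z) v)"

text \<open>
  The values of the two gradients of the potential when \<open>\<lambda>\<close> and \<open>\<mu>\<close> have vanishing third
  component; see lemma \<open>gradients_planar\<close> below.
\<close>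

definition planar_grad_lam :: "params \<Rightarrow> real^3 \<Rightarrow> real^3 \<Rightarrow> real^3" where
  "planar_grad_lam P l m =
     (grav P * m1 P * m2 P / norm l ^ 3) *\<^sub>R l
     - (grav P * m0 P * m2 P / M2 P *
         (m1 P / norm (x1 P l m) ^ 3 + beta1 P / norm (x1 P l m) ^ 5)) *\<^sub>R x1 P l m
     + (grav P * m0 P * m1 P / M2 P *
         (m2 P / norm (x2 P l m) ^ 3 + beta2 P / norm (x2 P l m) ^ 5)) *\<^sub>R x2 P l m"

definition planar_grad_mu :: "params \<Rightarrow> real^3 \<Rightarrow> real^3 \<Rightarrow> real^3" where
  "planar_grad_mu P l m =
     (grav P * m0 P *
         (m1 P / norm (x1 P l m) ^ 3 + beta1 P / norm (x1 P l m) ^ 5)) *\<^sub>R x1 P l m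
     + (grav P * m0 P *
         (m2 P / norm (x2 P l m) ^ 3 + beta2 P / norm (x2 P l m) ^ 5)) *\<^sub>R x2 P l m"

text \<open>In \<open>h1\<close> and \<open>h2\<close> the argument \<open>r\<close> stands for the modulus of \<open>\<lambda>\<close>.\<close>

definition h1 :: "params \<Rightarrow> real \<Rightarrow> real \<Rightarrow> real" where
  "h1 P r \<rho> =
     grav P * m1 P * m2 P / r ^ 3
     + grav P * m0 P * m1 P * sgn_pm (1 + \<rho>) / (M2 P * r ^ 3) *
         (m2 P / (1 + \<rho>) ^ 2 + beta2 P / ((1 + \<rho>) ^ 4 * r ^ 2))
     - grav P * m0 P * m2 P * sgn_pm \<rho> / (M2 P * r ^ 3) *
         (m1 P / \<rho> ^ 2 + beta1 P / (\<rho> ^ 4 * r ^ 2))"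

definition h2 :: "params \<Rightarrow> real \<Rightarrow> real \<Rightarrow> real" where
  "h2 P r \<rho> =
     grav P * m0 P * sgn_pm (1 + \<rho>) / r ^ 3 *
         (m2 P / (1 + \<rho>) ^ 2 + beta2 P / (r ^ 2 * (1 + \<rho>) ^ 4))
     + grav P * m0 P * sgn_pm \<rho> / r ^ 3 *
         (m1 P / \<rho> ^ 2 + beta1 P / (r ^ 2 * \<rho> ^ 4))"

text \<open>
  The points \<open>0\<close> and \<open>-1\<close>, where \<open>h1\<close> and \<open>h2\<close> are undefined on paper, are excluded:
  division by zero would otherwise give them meaningless values there.
\<close>

definition is_root :: "params \<Rightarrow> real \<Rightarrow> real \<Rightarrow> bool" where
  "is_root P r \<rho> \<longleftrightarrow> \<rho> \<noteq> 0 \<and> 1 + \<rho> \<noteq> 0 \<and>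
     m0 P * (m1 P + m2 P) * ((1 + \<rho>) * m2 P + \<rho> * m1 P) * h1 P r \<rho>
       = m1 P * m2 P * (m0 P + m1 P + m2 P) * h2 P r \<rho>"


subsection \<open>Consistency of the definitions\<close>

lemma inertia_mult: "(inertia A C *v x) $ i = (if i = 3 then C else A) * x $ i"
  by (simp add: inertia_def matrix_vector_mult_def if_distrib [of "\<lambda>t. t * _"] cong: if_cong)

lemma inertia_matrix_inv:
  assumes "A > 0" "C > 0"
  shows "inertia A C *v (matrix_inv (inertia A C) *v v) = v"
proof -
  have *: "inertia a c ** inertia a' c' = mat 1" if "a * a' = 1" "c * c' = 1" for a a' c c'
    using that
    by (auto simp: vec_eq_iff inertia_def matrix_matrix_mult_def mat_def sum_3 forall_3)
  have "inertia A C ** inertia (1 / A) (1 / C) = mat 1"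
    "inertia (1 / A) (1 / C) ** inertia A C = mat 1"
    using assms by (auto intro!: *)
  then have "\<exists>B. inertia A C ** B = mat 1 \<and> B ** inertia A C = mat 1"
    by blast
  then have "inertia A C ** matrix_inv (inertia A C) = mat 1"
    unfolding matrix_inv_def by (rule someI2_ex) blast
  then show ?thesis
    by (simp add: matrix_vector_mul_assoc)
qed

lemma momenta:
  assumes "admissible P"
  shows "Pi0 z = I0 P *v Omega0 P z + gyro_momentum P"
    and "Pi1 z = I1 P *v Omega1 P z"
    and "Pi2 z = I2 P *v Omega2 P z"
  using assms
  by (simp_all add: admissible_def Omega0_def Omega1_def Omega2_def I0_def I1_def I2_def
      inertia_matrix_inv)

lemma gradient_eqI:
  assumes "GDERIV f x :> D"
  shows "gradient f x = D"
  unfolding gradient_def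
proof (rule the_equality)
  fix E assume "GDERIV f x :> E"
  then have "(\<lambda>h. h \<bullet> E) = (\<lambda>h. h \<bullet> D)"
    using assms unfolding gderiv_def by (rule has_derivative_unique)
  then have "(E - D) \<bullet> E = (E - D) \<bullet> D" by (rule fun_cong)
  then have "(E - D) \<bullet> (E - D) = 0" by (simp add: inner_diff_right)
  then show "E = D" by simp
qed (fact assms)

lemma has_derivative_inverse_norm_power:
  fixes x :: "'a::real_inner"
  assumes "x \<noteq> 0"
  shows "((\<lambda>x. 1 / norm x ^ n) has_derivative (\<lambda>h. - real n * (h \<bullet> x) / norm x ^ (n + 2))) (at x)"
proof (cases n)
  case (Suc k)
  have "((\<lambda>x. 1 / norm x ^ n) has_derivative
      (\<lambda>h. - (real n * norm x ^ (n - 1) * (h \<bullet> sgn x)) / (norm x ^ n * norm x ^ n))) (at x)"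
    using assms
    by (auto intro!: derivative_eq_intros has_derivative_norm simp: fun_eq_iff field_simps)
  also have "(\<lambda>h. - (real n * norm x ^ (n - 1) * (h \<bullet> sgn x)) / (norm x ^ n * norm x ^ n))
      = (\<lambda>h. - real n * (h \<bullet> x) / norm x ^ (n + 2))"
    using assms Suc by (simp add: sgn_div_norm fun_eq_iff field_simps)
  finally show ?thesis .
qed simp

definition body_potential :: "real \<Rightarrow> real \<Rightarrow> real \<Rightarrow> real \<Rightarrow> real^3 \<Rightarrow> real" where
  "body_potential k m A C x = - (k * m / norm x)
     - (1 / 2) * (k * (2 * A + C) / norm x ^ 3 - 3 * k * (x \<bullet> (inertia A C *v x)) / norm x ^ 5)"

lemma has_derivative_body_potential:
  assumes "x \<noteq> 0"
  shows "(body_potential k m A C has_derivative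
     (\<lambda>h. h \<bullet> ((k * m / norm x ^ 3 + 3 * k * (2 * A + C) / (2 * norm x ^ 5)
               - 15 * k * (x \<bullet> (inertia A C *v x)) / (2 * norm x ^ 7)) *\<^sub>R x
             + (3 * k / norm x ^ 5) *\<^sub>R (inertia A C *v x)))) (at x)"
proof -
  have sym: "x \<bullet> (inertia A C *v h) = h \<bullet> (inertia A C *v x)" for h
    by (simp add: inner_vec_def inertia_mult mult_ac)
  have quad: "((\<lambda>x. x \<bullet> (inertia A C *v x)) has_derivative
      (\<lambda>h. 2 * (h \<bullet> (inertia A C *v x)))) (at x)"
    by (auto intro!: derivative_eq_intros
          bounded_linear.has_derivative [OF matrix_vector_mul_bounded_linear] simp: sym)
  note d = has_derivative_inverse_norm_power [OF assms]
  have "((\<lambda>x. - (k * m) * (1 / norm x ^ 1)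
     - (1 / 2) * (k * (2 * A + C) * (1 / norm x ^ 3)
         - 3 * k * ((x \<bullet> (inertia A C *v x)) * (1 / norm x ^ 5)))) has_derivative
     (\<lambda>h. - (k * m) * (- real 1 * (h \<bullet> x) / norm x ^ (1 + 2))
     - (1 / 2) * (k * (2 * A + C) * (- real 3 * (h \<bullet> x) / norm x ^ (3 + 2))
         - 3 * k * ((x \<bullet> (inertia A C *v x)) * (- real 5 * (h \<bullet> x) / norm x ^ (5 + 2))
             + (2 * (h \<bullet> (inertia A C *v x))) * (1 / norm x ^ 5))))) (at x)"
    by (intro has_derivative_diff has_derivative_mult_right has_derivative_mult d quad)
  also have "(\<lambda>x. - (k * m) * (1 / norm x ^ 1)
     - (1 / 2) * (k * (2 * A + C) * (1 / norm x ^ 3)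
         - 3 * k * ((x \<bullet> (inertia A C *v x)) * (1 / norm x ^ 5)))) = body_potential k m A C"
    by (simp add: fun_eq_iff body_potential_def)
  finally show ?thesis
  proof (rule has_derivative_eq_rhs, intro ext)
    fix h
    define a b q where "a = h \<bullet> x" and "b = h \<bullet> (inertia A C *v x)"
      and "q = x \<bullet> (inertia A C *v x)"
    show "- (k * m) * (- real 1 * (h \<bullet> x) / norm x ^ (1 + 2))
     - (1 / 2) * (k * (2 * A + C) * (- real 3 * (h \<bullet> x) / norm x ^ (3 + 2))
         - 3 * k * ((x \<bullet> (inertia A C *v x)) * (- real 5 * (h \<bullet> x) / norm x ^ (5 + 2))
             + (2 * (h \<bullet> (inertia A C *v x))) * (1 / norm x ^ 5)))
     = h \<bullet> ((k * m / norm x ^ 3 + 3 * k * (2 * A + C) / (2 * norm x ^ 5)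
               - 15 * k * (x \<bullet> (inertia A C *v x)) / (2 * norm x ^ 7)) *\<^sub>R x
             + (3 * k / norm x ^ 5) *\<^sub>R (inertia A C *v x))"
      unfolding inner_add_right inner_scaleR_right
      unfolding a_def [symmetric] b_def [symmetric] q_def [symmetric]
      by (simp add: algebra_simps add_divide_distrib diff_divide_distrib power3_eq_cube)
  qed
qed

lemma GDERIV_body_potential_planar:
  assumes "x \<noteq> 0" "x $ 3 = 0"
  shows "GDERIV (body_potential k m A C) x :>
     (k * (m / norm x ^ 3 + (3 / 2 * (C - A)) / norm x ^ 5)) *\<^sub>R x"
proof -
  have I: "inertia A C *v x = A *\<^sub>R x"
    using assms(2) by (auto simp: vec_eq_iff inertia_mult)
  have "norm x ^ 7 = norm x ^ 5 * norm x ^ 2" by (simp flip: power_add)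
  then have "x \<bullet> x / norm x ^ 7 = 1 / norm x ^ 5"
    using assms(1) by (simp add: power2_norm_eq_inner)
  then have n: "x \<bullet> (A *\<^sub>R x) / norm x ^ 7 = A / norm x ^ 5"
    by (metis inner_scaleR_right times_divide_eq_right mult.right_neutral)
  have "k * m / norm x ^ 3 + 3 * k * (2 * A + C) / (2 * norm x ^ 5)
      - 15 * k * (x \<bullet> (A *\<^sub>R x)) / (2 * norm x ^ 7) + 3 * k / norm x ^ 5 * A
    = k * m / norm x ^ 3 + 3 * k * (2 * A + C) / (2 * norm x ^ 5)
      - 15 * k / 2 * (x \<bullet> (A *\<^sub>R x) / norm x ^ 7) + 3 * k / norm x ^ 5 * A"
    by simp
  also have "\<dots> = k * (m / norm x ^ 3 + (3 / 2 * (C - A)) / norm x ^ 5)"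
    unfolding n by (simp add: algebra_simps add_divide_distrib diff_divide_distrib)
  finally have e: "(k * m / norm x ^ 3 + 3 * k * (2 * A + C) / (2 * norm x ^ 5)
      - 15 * k * (x \<bullet> (A *\<^sub>R x)) / (2 * norm x ^ 7)) *\<^sub>R x + (3 * k / norm x ^ 5) *\<^sub>R (A *\<^sub>R x)
    = (k * (m / norm x ^ 3 + (3 / 2 * (C - A)) / norm x ^ 5)) *\<^sub>R x"
    by (simp only: scaleR_scaleR flip: scaleR_left.add)
  show ?thesis
    using has_derivative_body_potential [OF assms(1), of k m A C]
    unfolding gderiv_def I e .
qed

lemma potential_bodies:
  "potential P l m = - (grav P * m1 P * m2 P) * (1 / norm l ^ 1)
     + body_potential (grav P * m0 P) (m1 P) (A1 P) (C1 P) (x1 P l m)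
     + body_potential (grav P * m0 P) (m2 P) (A2 P) (C2 P) (x2 P l m)"
proof -
  have "grav P * m1 P * m0 P = grav P * m0 P * m1 P" "grav P * m2 P * m0 P = grav P * m0 P * m2 P"
    and 3: "3 * grav P * m0 P = 3 * (grav P * m0 P)"
    by simp_all
  then show ?thesis
    unfolding potential_def V1_def V2_def body_potential_def I1_def I2_def 3
    by (simp add: add_divide_distrib diff_divide_distrib mult_ac)
qed

lemma gradients_planar:
  assumes "lam z \<noteq> 0" "x1 P (lam z) (mu z) \<noteq> 0" "x2 P (lam z) (mu z) \<noteq> 0"
    and "lam z $ 3 = 0" "mu z $ 3 = 0"
  shows "grad_lam P z = planar_grad_lam P (lam z) (mu z)"
    and "grad_mu P z = planar_grad_mu P (lam z) (mu z)"
proof -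
  let ?l = "lam z" and ?m = "mu z"
  have z: "x1 P ?l ?m $ 3 = 0" "x2 P ?l ?m $ 3 = 0"
    using assms(4,5) by (auto simp: x1_def x2_def)
  note b1 = GDERIV_body_potential_planar [OF assms(2) z(1), unfolded gderiv_def,
      of "grav P * m0 P" "m1 P" "A1 P" "C1 P", folded beta1_def]
  note b2 = GDERIV_body_potential_planar [OF assms(3) z(2), unfolded gderiv_def,
      of "grav P * m0 P" "m2 P" "A2 P" "C2 P", folded beta2_def]
  have x1l: "((\<lambda>l. x1 P l ?m) has_derivative (\<lambda>h. - (m2 P / M2 P) *\<^sub>R h)) (at ?l)"
    and x2l: "((\<lambda>l. x2 P l ?m) has_derivative (\<lambda>h. (m1 P / M2 P) *\<^sub>R h)) (at ?l)"
    and x1m: "((\<lambda>m. x1 P ?l m) has_derivative (\<lambda>h. h)) (at ?m)"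
    and x2m: "((\<lambda>m. x2 P ?l m) has_derivative (\<lambda>h. h)) (at ?m)"
    unfolding x1_def x2_def by (auto intro!: derivative_eq_intros)
  have "GDERIV (\<lambda>l. potential P l ?m) ?l :> planar_grad_lam P ?l ?m"
    unfolding gderiv_def potential_bodies
    by (rule has_derivative_eq_rhs [OF has_derivative_add [OF has_derivative_add
          [OF has_derivative_mult_right [OF has_derivative_inverse_norm_power [OF assms(1)]]
              has_derivative_compose [OF x1l b1]] has_derivative_compose [OF x2l b2]]])
       (unfold fun_eq_iff planar_grad_lam_def inner_add_right inner_diff_right
          inner_scaleR_right inner_scaleR_left, simp add: power3_eq_cube mult_ac)
  then show "grad_lam P z = planar_grad_lam P ?l ?m"
    unfolding grad_lam_def by (rule gradient_eqI)
  have "GDERIV (\<lambda>m. potential P ?l m) ?m :> planar_grad_mu P ?l ?m"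
    unfolding gderiv_def potential_bodies
    by (rule has_derivative_eq_rhs [OF has_derivative_add [OF has_derivative_add
          [OF has_derivative_const has_derivative_compose [OF x1m b1]]
          has_derivative_compose [OF x2m b2]]])
       (simp add: fun_eq_iff planar_grad_mu_def inner_add_right)
  then show "grad_mu P z = planar_grad_mu P ?l ?m"
    unfolding grad_mu_def by (rule gradient_eqI)
qed

end

theory Submission
  imports Defs
begin

text \<open>
  Since \<open>\<Omega>\<^sub>0\<close> is orthogonal to \<open>\<lambda>\<close> and \<open>\<mu>\<close>, eliminating the momenta turns the equilibrium
  conditions into the balance of attraction and centrifugal force,
  \<open>\<nabla>\<^sub>\<lambda>V = g\<^sub>1 |\<Omega>\<^sub>0|\<^sup>2 \<lambda>\<close> and \<open>\<nabla>\<^sub>\<mu>V = g\<^sub>2 |\<Omega>\<^sub>0|\<^sup>2 \<mu>\<close> (lemma \<open>centrifugal_balance\<close>).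
  The bodies are aligned, so with \<open>x\<^sub>1 = \<rho>\<lambda>\<close> one also has \<open>x\<^sub>2 = (1 + \<rho>)\<lambda>\<close> and
  \<open>\<mu> = (((1 + \<rho>)m\<^sub>2 + \<rho>m\<^sub>1)/M\<^sub>2)\<lambda>\<close>, and both gradients are multiples of \<open>\<lambda>\<close>; the functions
  \<open>h\<^sub>1\<close> and \<open>h\<^sub>2\<close> are exactly the two factors (lemma \<open>planar_gradients_on_line\<close>). Comparing
  coefficients of \<open>\<lambda> \<noteq> 0\<close> gives
  \[ h_1(\rho) = g_1 |\Omega_0|^2, \qquad
     h_2(\rho) = g_2 |\Omega_0|^2 \, \frac{(1+\rho)m_2 + \rho m_1}{M_2}. \]
  The first equation is the formula for the angular velocity, and eliminating \<open>|\<Omega>\<^sub>0|\<^sup>2\<close>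
  between the two is the equation for \<open>\<rho>\<close>. So the root is not found analytically: the
  ratio realised by the given equilibrium is one.
\<close>

text \<open>
  The double product \<open>(v \<times> \<omega>) \<times> \<omega>\<close> is the centripetal term; orthogonality removes its
  component along \<open>\<omega>\<close>.
\<close>

lemma centrifugal_balance:
  assumes g: "g \<noteq> 0"
    and rate: "(1 / g) *\<^sub>R p + cross3 v \<omega> = 0"
    and force: "cross3 p \<omega> = F"
    and orth: "orthogonal \<omega> v"
  shows "F = (g * (norm \<omega>)\<^sup>2) *\<^sub>R v"
proof -
  have "p = g *\<^sub>R ((1 / g) *\<^sub>R p)"
    using g by simp
  also have "(1 / g) *\<^sub>R p = - cross3 v \<omega>"
    using rate by (simp add: eq_neg_iff_add_eq_0)
  finally have p: "p = - (g *\<^sub>R cross3 v \<omega>)"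
    by simp
  have "cross3 (cross3 v \<omega>) \<omega> = - ((norm \<omega>)\<^sup>2 *\<^sub>R v)"
    using orth cross_skew [of "cross3 v \<omega>" \<omega>]
    by (simp add: Lagrange orthogonal_def power2_norm_eq_inner inner_commute)
  then show ?thesis
    using force unfolding p by (simp add: cross_minus_left cross_mult_left)
qed

text \<open>
  The sign functions in \<open>h\<^sub>1\<close> and \<open>h\<^sub>2\<close> come from \<open>s / |s|\<close>, which is \<open>sgn_pm s\<close> away from
  the collision \<open>s = 0\<close>.
\<close>

lemma attraction_on_line:
  fixes l :: "'a::real_normed_vector"
  assumes "s \<noteq> 0"
  shows "(m / norm (s *\<^sub>R l) ^ 3 + b / norm (s *\<^sub>R l) ^ 5) * s
    = sgn_pm s / norm l ^ 3 * (m / s ^ 2 + b / (s ^ 4 * norm l ^ 2))"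
  using assms by (cases "l = 0") (auto simp: sgn_pm_def field_simps eval_nat_numeral)

lemma x2_eq_x1_plus:
  assumes "M2 P \<noteq> 0"
  shows "x2 P l m = x1 P l m + l"
proof -
  have "m1 P / M2 P + m2 P / M2 P = 1"
    using assms by (simp add: M2_def add_divide_distrib [symmetric])
  then have "(m1 P / M2 P) *\<^sub>R l + (m2 P / M2 P) *\<^sub>R l = l"
    by (metis scaleR_add_left scaleR_one)
  then show ?thesis
    by (simp add: x1_def x2_def algebra_simps)
qed

lemma planar_gradients_on_line:
  assumes x1: "x1 P l m = \<rho> *\<^sub>R l" and x2: "x2 P l m = (1 + \<rho>) *\<^sub>R l"
    and \<rho>: "\<rho> \<noteq> 0" "1 + \<rho> \<noteq> 0"
  shows "planar_grad_lam P l m = h1 P (norm l) \<rho> *\<^sub>R l"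
    and "planar_grad_mu P l m = h2 P (norm l) \<rho> *\<^sub>R l"
proof -
  note a1 = attraction_on_line [OF \<rho>(1), of "m1 P" l "beta1 P"]
  note a2 = attraction_on_line [OF \<rho>(2), of "m2 P" l "beta2 P"]
  define a where "a = m1 P / norm (\<rho> *\<^sub>R l) ^ 3 + beta1 P / norm (\<rho> *\<^sub>R l) ^ 5"
  define b where "b = m2 P / norm ((1 + \<rho>) *\<^sub>R l) ^ 3 + beta2 P / norm ((1 + \<rho>) *\<^sub>R l) ^ 5"
  have "h1 P (norm l) \<rho> = grav P * m1 P * m2 P / norm l ^ 3
      - grav P * m0 P * m2 P / M2 P * (a * \<rho>) + grav P * m0 P * m1 P / M2 P * (b * (1 + \<rho>))"
    unfolding a_def b_def a1 a2 by (simp add: h1_def)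
  then show "planar_grad_lam P l m = h1 P (norm l) \<rho> *\<^sub>R l"
    unfolding planar_grad_lam_def x1 x2 a_def [symmetric] b_def [symmetric]
    by (simp only: scaleR_scaleR mult.assoc flip: scaleR_add_left scaleR_diff_left)
  have "h2 P (norm l) \<rho> = grav P * m0 P * (a * \<rho>) + grav P * m0 P * (b * (1 + \<rho>))"
    unfolding a_def b_def a1 a2 by (simp add: h2_def mult_ac)
  then show "planar_grad_mu P l m = h2 P (norm l) \<rho> *\<^sub>R l"
    unfolding planar_grad_mu_def x1 x2 a_def [symmetric] b_def [symmetric]
    by (simp only: scaleR_scaleR mult.assoc flip: scaleR_add_left)
qed

theorem proposition7:
  fixes P :: params and z :: state
  assumes "admissible P"
    and "eulerian_equilibrium P z"
    and "grad_lam P z = planar_grad_lam P (lam z) (mu z)"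
    and "grad_mu P z = planar_grad_mu P (lam z) (mu z)"
  shows "(\<exists>\<rho>. is_root P (norm (lam z)) \<rho>) \<and>
         (\<exists>!\<rho>. mu z - (m2 P / M2 P) *\<^sub>R lam z = \<rho> *\<^sub>R lam z) \<and>
         (\<forall>\<rho>. mu z - (m2 P / M2 P) *\<^sub>R lam z = \<rho> *\<^sub>R lam z \<longrightarrow>
            is_root P (norm (lam z)) \<rho> \<and>
            (norm (Omega0 P z))\<^sup>2
              = (m1 P + m2 P) / (m1 P * m2 P) * h1 P (norm (lam z)) \<rho>)"
proof -
  let ?l = "lam z" and ?m = "mu z" and ?r = "norm (lam z)"
  define w where "w = (norm (Omega0 P z))\<^sup>2"
  have pos: "m0 P > 0" "m1 P > 0" "m2 P > 0"
    using assms(1) by (auto simp: admissible_def)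
  then have M: "M2 P > 0" "M1 P > 0"
    by (auto simp: M2_def M1_def)
  then have g: "g1 P \<noteq> 0" "g2 P \<noteq> 0"
    using pos by (auto simp: g1_def g2_def)
  have eq: "relative_equilibrium P z" and col: "collinear {0, ?l, ?m}"
    and orth: "orthogonal (Omega0 P z) ?l" "orthogonal (Omega0 P z) ?m"
    using assms(2) by (auto simp: eulerian_equilibrium_def span_base)
  then have l: "?l \<noteq> 0" and nz: "x1 P ?l ?m \<noteq> 0" "x2 P ?l ?m \<noteq> 0"
    by (auto simp: relative_equilibrium_def)
  have grad_lam: "planar_grad_lam P ?l ?m = (g1 P * w) *\<^sub>R ?l"
    using eq unfolding w_def relative_equilibrium_def assms(3)
    by (intro centrifugal_balance [OF g(1) _ _ orth(1)]) auto
  have grad_mu: "planar_grad_mu P ?l ?m = (g2 P * w) *\<^sub>R ?m"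
    using eq unfolding w_def relative_equilibrium_def assms(4)
    by (intro centrifugal_balance [OF g(2) _ _ orth(2)]) auto
  have key: "is_root P ?r \<rho> \<and> w = (m1 P + m2 P) / (m1 P * m2 P) * h1 P ?r \<rho>"
    if "?m - (m2 P / M2 P) *\<^sub>R ?l = \<rho> *\<^sub>R ?l" for \<rho>
  proof -
    define \<kappa> where "\<kappa> = (1 + \<rho>) * m2 P + \<rho> * m1 P"
    have x1: "x1 P ?l ?m = \<rho> *\<^sub>R ?l"
      using that by (simp add: x1_def)
    have x2: "x2 P ?l ?m = (1 + \<rho>) *\<^sub>R ?l"
      using M by (simp add: x2_eq_x1_plus x1 algebra_simps)
    have \<rho>: "\<rho> \<noteq> 0" "1 + \<rho> \<noteq> 0"
      using nz unfolding x1 x2 by auto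
    have "?m = (\<rho> + m2 P / M2 P) *\<^sub>R ?l"
      using that by (simp add: algebra_simps)
    also have "\<rho> + m2 P / M2 P = \<kappa> / M2 P"
      using M by (simp add: \<kappa>_def M2_def field_simps)
    finally have m: "?m = (\<kappa> / M2 P) *\<^sub>R ?l" .
    note line = planar_gradients_on_line [OF x1 x2 \<rho>]
    have h1: "h1 P ?r \<rho> = g1 P * w"
      using line(1) grad_lam l by simp
    have "h2 P ?r \<rho> *\<^sub>R ?l = (g2 P * w * (\<kappa> / M2 P)) *\<^sub>R ?l"
      using line(2) grad_mu m by (metis scaleR_scaleR)
    then have h2: "h2 P ?r \<rho> = g2 P * w * (\<kappa> / M2 P)"
      using l by simp
    have "m0 P * M2 P * \<kappa> * h1 P ?r \<rho> = m1 P * m2 P * M1 P * h2 P ?r \<rho>"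
      using M by (simp add: h1 h2 g1_def g2_def)
    then have "is_root P ?r \<rho>"
      using \<rho> by (simp add: is_root_def \<kappa>_def M1_def M2_def)
    moreover have "w = M2 P / (m1 P * m2 P) * h1 P ?r \<rho>"
      using M pos by (simp add: h1 g1_def)
    ultimately show ?thesis
      by (simp add: M2_def)
  qed
  obtain c where c: "?m = c *\<^sub>R ?l"
    using col l by (auto simp: collinear_lemma)
  have ex: "?m - (m2 P / M2 P) *\<^sub>R ?l = (c - m2 P / M2 P) *\<^sub>R ?l"
    by (simp add: c scaleR_diff_left)
  have "\<exists>!\<rho>. ?m - (m2 P / M2 P) *\<^sub>R ?l = \<rho> *\<^sub>R ?l"
    using ex l by auto
  then show ?thesis
    using key ex unfolding w_def by blast
qed

end
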